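(* Let $G$ be a finite connected simple graph with $|V(G)|\geq 3$ and $\gamma(G)=1$. Then $G$ is an ASR-graph if and only if there exists a (possibly null) finite simple graph $H$ (not necessarily connected) such that $G=K_3+H$ (up to isomorphism).
   Context: $\gamma(G)$ denotes the domination number of a finite simple graph $G$. For an edge $e=uv$ of $G$, $G-e$ is the graph obtained by deleting $e$, and $G_e$ is the graph obtained by subdividing $e$: delete $e$, add a new vertex $w$ and the edges $uw$ and $wv$. A finite connected simple graph $G$ of order at least two is an ASR-graph (anti-sub-removable graph) if $\gamma(G-e)\neq\gamma(G_e)$ for every edge $e$ of $G$. For vertex-disjoint graphs $G$ and $H$, the sum $G+H$ is the graph with vertex set $V(G)\cup V(H)$ and edge set $E(G)\cup E(H)\cup\{xy: x\in V(G),\ y\in V(H)\}$. The null graph is the graph with no vertices. *)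

theory Defs
  imports Main
begin

datatype 'a graph = Graph (verts: "'a set") (edges: "'a set set")

definition finite_simple_graph :: "'a graph \<Rightarrow> bool" where
  "finite_simple_graph G \<longleftrightarrow>
     finite (verts G) \<and> (\<forall>e\<in>edges G. e \<subseteq> verts G \<and> card e = 2)"

definition adj :: "'a graph \<Rightarrow> 'a \<Rightarrow> 'a \<Rightarrow> bool" where
  "adj G u v \<longleftrightarrow> {u, v} \<in> edges G"

definition connected_graph :: "'a graph \<Rightarrow> bool" where
  "connected_graph G \<longleftrightarrow>
     verts G \<noteq> {} \<and> (\<forall>u\<in>verts G. \<forall>v\<in>verts G. (adj G)\<^sup>*\<^sup>* u v)"

definition dominating_set :: "'a graph \<Rightarrow> 'a set \<Rightarrow> bool" where
  "dominating_set G S \<longleftrightarrow>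
     S \<subseteq> verts G \<and> (\<forall>v\<in>verts G - S. \<exists>u\<in>S. adj G u v)"

(* Meaningful for finite graphs only; the minimum then ranges over a finite set,
   which is nonempty because verts G dominates G. *)
definition domination_number :: "'a graph \<Rightarrow> nat" where
  "domination_number G = Min (card ` {S. dominating_set G S})"

definition delete_edge :: "'a graph \<Rightarrow> 'a set \<Rightarrow> 'a graph" where
  "delete_edge G e = Graph (verts G) (edges G - {e})"

(* The old vertices are the Some x; the new vertex w is None, hence always fresh. *)
definition subdivide_edge :: "'a graph \<Rightarrow> 'a set \<Rightarrow> 'a option graph" where
  "subdivide_edge G e =
     Graph (insert None (Some ` verts G))
           ((`) Some ` (edges G - {e}) \<union> (\<lambda>u. {Some u, None}) ` e)"

definition ASR_graph :: "'a graph \<Rightarrow> bool" where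
  "ASR_graph G \<longleftrightarrow>
     finite_simple_graph G \<and> connected_graph G \<and> card (verts G) \<ge> 2 \<and>
     (\<forall>e\<in>edges G. domination_number (delete_edge G e) \<noteq> domination_number (subdivide_edge G e))"

(* Intended for graphs with disjoint vertex sets. *)
definition graph_sum :: "'a graph \<Rightarrow> 'a graph \<Rightarrow> 'a graph" where
  "graph_sum G H =
     Graph (verts G \<union> verts H)
           (edges G \<union> edges H \<union> {{x, y} | x y. x \<in> verts G \<and> y \<in> verts H})"

definition complete_graph :: "'a set \<Rightarrow> 'a graph" where
  "complete_graph V = Graph V {{u, v} | u v. u \<in> V \<and> v \<in> V \<and> u \<noteq> v}"

definition K3 :: "nat graph" where
  "K3 = complete_graph {0, 1, 2}"

definition graph_isomorphic :: "'a graph \<Rightarrow> 'b graph \<Rightarrow> bool" where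
  "graph_isomorphic G H \<longleftrightarrow>
     (\<exists>f. bij_betw f (verts G) (verts H) \<and>
          (\<forall>u\<in>verts G. \<forall>v\<in>verts G. adj G u v \<longleftrightarrow> adj H (f u) (f v)))"

end

theory Submission
  imports Defs
begin

text \<open>
  Since $\gamma(G) = 1$, the graph has a universal vertex $z$. Subdividing any edge $e$ gives
  domination number exactly 2: the new vertex sees only the ends of $e$, these no longer see each
  other, and $z$ together with an end of $e$ dominates everything. The same pair dominates
  $G - e$, so $\gamma(G - e) \neq \gamma(G_e)$ iff $\gamma(G - e) = 1$, i.e. iff some universal
  vertex of $G$ is not an end of $e$. As universal vertices are pairwise adjacent, this holds for
  every edge iff there are at least three of them, and three universal vertices split off a $K_3$.
\<close>

section \<open>Universal vertices and domination numbers 1 and 2\<close>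

definition universal_vertices :: "'a graph \<Rightarrow> 'a set" where
  "universal_vertices G = {z \<in> verts G. \<forall>v\<in>verts G - {z}. adj G z v}"

lemma dominating_set_singleton:
  "dominating_set G {z} \<longleftrightarrow> z \<in> universal_vertices G"
  by (auto simp: dominating_set_def universal_vertices_def)

lemma adj_commute: "adj G x y \<longleftrightarrow> adj G y x"
  by (simp add: adj_def insert_commute)

lemma adj_verts:
  assumes "finite_simple_graph G" "adj G x y"
  shows "x \<in> verts G" "y \<in> verts G" "x \<noteq> y"
proof -
  have "{x, y} \<subseteq> verts G" "card {x, y} = 2"
    using assms by (auto simp: finite_simple_graph_def adj_def)
  then show "x \<in> verts G" "y \<in> verts G" "x \<noteq> y" by (auto split: if_splits)
qed

text \<open>The facts about \<open>Min\<close> behind \<open>domination_number\<close> require a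
  finite set; dominating sets all lie in the power set of the finite vertex set.\<close>

lemma finite_card_dominating_sets:
  assumes "finite (verts G)"
  shows "finite (card ` {S. dominating_set G S})"
proof -
  have "{S. dominating_set G S} \<subseteq> Pow (verts G)" by (auto simp: dominating_set_def)
  then show ?thesis using assms by (meson finite_Pow_iff finite_imageI finite_subset)
qed

lemma domination_number_le:
  assumes "finite (verts G)" "dominating_set G S"
  shows "domination_number G \<le> card S"
  using finite_card_dominating_sets[OF assms(1)] assms(2)
  by (auto simp: domination_number_def)

lemma domination_number_attained:
  assumes "finite (verts G)"
  obtains S where "dominating_set G S" "card S = domination_number G"
proof -
  have "dominating_set G (verts G)" by (simp add: dominating_set_def)
  then have "domination_number G \<in> card ` {S. dominating_set G S}"
    unfolding domination_number_def
    using finite_card_dominating_sets[OF assms] by (intro Min_in) auto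
  then show ?thesis using that by auto
qed

lemma domination_number_pos:
  assumes "finite (verts G)" "verts G \<noteq> {}"
  shows "domination_number G > 0"
proof -
  obtain S where S: "dominating_set G S" "card S = domination_number G"
    using domination_number_attained[OF assms(1)] .
  then have "finite S" "S \<noteq> {}"
    using assms by (auto simp: dominating_set_def intro: finite_subset)
  then show ?thesis using S(2) by (metis card_gt_0_iff)
qed

lemma domination_number_eq_1_iff:
  assumes "finite (verts G)" "verts G \<noteq> {}"
  shows "domination_number G = 1 \<longleftrightarrow> universal_vertices G \<noteq> {}"
proof
  assume "domination_number G = 1"
  then obtain S where "dominating_set G S" "card S = 1"
    using domination_number_attained[OF assms(1)] by metis
  then show "universal_vertices G \<noteq> {}"
    by (metis card_1_singletonE dominating_set_singleton empty_iff)
next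
  assume "universal_vertices G \<noteq> {}"
  then obtain z where "dominating_set G {z}" by (auto simp: dominating_set_singleton)
  then have "domination_number G \<le> 1" using domination_number_le[OF assms(1)] by fastforce
  then show "domination_number G = 1" using domination_number_pos[OF assms] by simp
qed

text \<open>The pair bounds the number from above, and the absence of a universal vertex excludes 1.
  This form serves both the deleted and the subdivided graph.\<close>

lemma domination_number_eq_2:
  assumes "finite (verts G)" "verts G \<noteq> {}" "universal_vertices G = {}"
    and "dominating_set G {x, y}"
  shows "domination_number G = 2"
proof -
  have "card {x, y} \<le> 2" by (simp add: card_insert_if)
  then have "domination_number G \<le> 2"
    using domination_number_le[OF assms(1,4)] by simp
  moreover have "domination_number G \<noteq> 1"
    using domination_number_eq_1_iff[OF assms(1,2)] assms(3) by simp
  ultimately show ?thesis using domination_number_pos[OF assms(1,2)] by simp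
qed

section \<open>Edge deletion and edge subdivision\<close>

lemma verts_delete_edge [simp]: "verts (delete_edge G e) = verts G"
  by (simp add: delete_edge_def)

lemma adj_delete_edge: "adj (delete_edge G e) x y \<longleftrightarrow> adj G x y \<and> {x, y} \<noteq> e"
  by (auto simp: delete_edge_def adj_def)

lemma verts_subdivide_edge [simp]:
  "verts (subdivide_edge G e) = insert None (Some ` verts G)"
  by (simp add: subdivide_edge_def)

text \<open>Taking images under \<open>Some\<close> is injective on sets, so a lifted edge
  determines the original one; the two new edges contain \<open>None\<close> and cannot
  interfere.\<close>

lemma adj_subdivide_edge_Some:
  fixes G :: "'a graph"
  shows "adj (subdivide_edge G e) (Some x) (Some y) \<longleftrightarrow> adj G x y \<and> {x, y} \<noteq> e"
proof -
  have "inj ((`) (Some :: 'a \<Rightarrow> 'a option))" by (simp add: inj_def inj_image_eq_iff)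
  moreover have "{Some x, Some y} = Some ` {x, y}" by simp
  ultimately have "{Some x, Some y} \<in> (`) Some ` A \<longleftrightarrow> {x, y} \<in> A" for A
    by (simp only: inj_image_mem_iff)
  moreover have "{Some x, Some y} \<notin> (\<lambda>u. {Some u, None}) ` e" by blast
  ultimately show ?thesis by (simp add: subdivide_edge_def adj_def)
qed

lemma adj_subdivide_edge_None:
  "adj (subdivide_edge G e) None (Some x) \<longleftrightarrow> x \<in> e"
  "adj (subdivide_edge G e) (Some x) None \<longleftrightarrow> x \<in> e"
proof -
  have "{None, Some x} \<notin> (`) Some ` (edges G - {e})" by blast
  moreover have "{None, Some x} \<in> (\<lambda>u. {Some u, None}) ` e \<longleftrightarrow> x \<in> e"
    by (simp add: image_iff doubleton_eq_iff)
  ultimately show *: "adj (subdivide_edge G e) None (Some x) \<longleftrightarrow> x \<in> e"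
    by (simp add: subdivide_edge_def adj_def)
  show "adj (subdivide_edge G e) (Some x) None \<longleftrightarrow> x \<in> e"
    by (subst adj_commute) (rule *)
qed

text \<open>Each end of the deleted edge loses the other end as a neighbour, while every other
  vertex keeps all its neighbours.\<close>

lemma universal_vertices_delete_edge:
  assumes "finite_simple_graph G" "adj G u v"
  shows "universal_vertices (delete_edge G {u, v}) = universal_vertices G - {u, v}"
  using adj_verts[OF assms]
  by (auto simp: universal_vertices_def adj_delete_edge doubleton_eq_iff)

text \<open>The new vertex misses any third vertex \<open>t\<close>. An old universal vertex would
  have to see the new vertex, hence be \<open>u\<close> or \<open>v\<close>, but these two are no
  longer adjacent. Order at least three matters: subdividing the edge of K_2 gives a path whose
  middle vertex is universal.\<close>

lemma universal_vertices_subdivide_edge: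
  assumes "finite_simple_graph G" "adj G u v" "card (verts G) \<ge> 3"
  shows "universal_vertices (subdivide_edge G {u, v}) = {}"
proof -
  have "\<not> verts G \<subseteq> {u, v}"
  proof
    assume "verts G \<subseteq> {u, v}"
    then have "card (verts G) \<le> card {u, v}" by (intro card_mono) auto
    then show False using assms(3) by (simp add: card_insert_if split: if_splits)
  qed
  then obtain t where t: "t \<in> verts G" "t \<notin> {u, v}" by blast
  have uv: "u \<in> verts G" "v \<in> verts G" "u \<noteq> v" using adj_verts[OF assms(1,2)] .
  have "x \<notin> universal_vertices (subdivide_edge G {u, v})" for x
  proof
    assume x: "x \<in> universal_vertices (subdivide_edge G {u, v})"
    then have *: "adj (subdivide_edge G {u, v}) x y"
      if "y \<in> insert None (Some ` verts G)" "y \<noteq> x" for y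
      using that by (simp add: universal_vertices_def)
    show False
    proof (cases x)
      case None
      then show False using *[of "Some t"] t by (simp add: adj_subdivide_edge_None)
    next
      case (Some a)
      then have "a = u \<or> a = v" using *[of None] by (simp add: adj_subdivide_edge_None)
      then show False
        using *[of "Some u"] *[of "Some v"] uv Some
        by (auto simp: adj_subdivide_edge_Some)
    qed
  qed
  then show ?thesis by blast
qed

text \<open>The vertex \<open>z\<close> loses a neighbour only if \<open>v = z\<close>, and then the
  lost neighbour is \<open>u\<close>, which belongs to the pair.\<close>

lemma dominating_pair_delete_edge:
  assumes "finite_simple_graph G" "adj G u v" "z \<in> universal_vertices G" "u \<noteq> z"
  shows "dominating_set (delete_edge G {u, v}) {z, u}"
  using assms(3,4) adj_verts[OF assms(1,2)]
  by (auto simp: dominating_set_def universal_vertices_def adj_delete_edge doubleton_eq_iff)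

text \<open>Old vertices are dominated as after deletion, and the new vertex is a neighbour of
  \<open>Some u\<close>.\<close>

lemma dominating_pair_subdivide_edge:
  assumes "finite_simple_graph G" "adj G u v" "z \<in> universal_vertices G" "u \<noteq> z"
  shows "dominating_set (subdivide_edge G {u, v}) {Some z, Some u}"
  using assms(3,4) adj_verts[OF assms(1,2)]
  by (auto simp: dominating_set_def universal_vertices_def adj_subdivide_edge_Some
      adj_subdivide_edge_None doubleton_eq_iff)

section \<open>The ASR condition in terms of universal vertices\<close>

text \<open>Subdivision always yields 2, so everything depends on whether deletion yields 1 or 2,
  that is, on whether a universal vertex outside \<open>e\<close> survives.\<close>

lemma domination_number_delete_neq_subdivide_iff:
  assumes "finite_simple_graph G" "card (verts G) \<ge> 3" "universal_vertices G \<noteq> {}"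
    and "e \<in> edges G"
  shows "domination_number (delete_edge G e) \<noteq> domination_number (subdivide_edge G e)
    \<longleftrightarrow> \<not> universal_vertices G \<subseteq> e"
proof -
  obtain z where z: "z \<in> universal_vertices G" using assms(3) by blast
  have "card e = 2" using assms(1,4) by (auto simp: finite_simple_graph_def)
  \<comment> \<open>At most one end of \<open>e\<close> is \<open>z\<close>, so the ends can be
    named with \<open>u\<close> different from \<open>z\<close>; \<open>v = z\<close> remains
    possible.\<close>
  then obtain u v where e: "e = {u, v}" "u \<noteq> z"
    by (metis card_2_iff insert_commute)
  have uv: "adj G u v" using assms(4) e by (simp add: adj_def)
  have fin: "finite (verts G)" using assms(1) by (simp add: finite_simple_graph_def)
  have ne: "verts G \<noteq> {}" using assms(2) by auto
  have sub: "domination_number (subdivide_edge G e) = 2"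
    using fin universal_vertices_subdivide_edge[OF assms(1) uv assms(2)]
      dominating_pair_subdivide_edge[OF assms(1) uv z e(2)] e(1)
    by (intro domination_number_eq_2) auto
  have U: "universal_vertices (delete_edge G e) = universal_vertices G - e"
    using universal_vertices_delete_edge[OF assms(1) uv] e(1) by simp
  show ?thesis
  proof (cases "universal_vertices G \<subseteq> e")
    case True
    then have "domination_number (delete_edge G e) = 2"
      using fin ne U dominating_pair_delete_edge[OF assms(1) uv z e(2)] e(1)
      by (intro domination_number_eq_2) auto
    then show ?thesis using sub True by simp
  next
    case False
    then have "domination_number (delete_edge G e) = 1"
      using domination_number_eq_1_iff[of "delete_edge G e"] fin ne U by auto
    then show ?thesis using sub False by simp
  qed
qed

lemma universal_vertices_pair:
  assumes "x \<in> universal_vertices G" "y \<in> verts G" "x \<noteq> y"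
  shows "{x, y} \<in> edges G"
  using assms by (auto simp: universal_vertices_def adj_def)

lemma ASR_graph_iff_card_universal_vertices:
  assumes "finite_simple_graph G" "connected_graph G" "card (verts G) \<ge> 3"
    and "domination_number G = 1"
  shows "ASR_graph G \<longleftrightarrow> card (universal_vertices G) \<ge> 3"
proof -
  have fin: "finite (verts G)" using assms(1) by (simp add: finite_simple_graph_def)
  have ne: "verts G \<noteq> {}" using assms(3) by auto
  have U: "universal_vertices G \<subseteq> verts G" by (auto simp: universal_vertices_def)
  have finU: "finite (universal_vertices G)" using fin U by (rule rev_finite_subset)
  have neU: "universal_vertices G \<noteq> {}"
    using domination_number_eq_1_iff[OF fin ne] assms(4) by simp
  have ASR: "ASR_graph G \<longleftrightarrow> (\<forall>e\<in>edges G. \<not> universal_vertices G \<subseteq> e)"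
    using assms domination_number_delete_neq_subdivide_iff[OF assms(1,3) neU]
    by (auto simp: ASR_graph_def)
  show ?thesis
  proof
    assume "ASR_graph G"
    then have noe: "\<not> universal_vertices G \<subseteq> e" if "e \<in> edges G" for e
      using ASR that by blast
    obtain z where z: "z \<in> universal_vertices G" using neU by blast
    show "card (universal_vertices G) \<ge> 3"
    proof (rule ccontr)
      assume "\<not> card (universal_vertices G) \<ge> 3"
      then have "card (universal_vertices G - {z}) \<le> 1" using z finU by simp
      then have "\<forall>a\<in>universal_vertices G - {z}. \<forall>b\<in>universal_vertices G - {z}. a = b"
        using finU by (subst (asm) One_nat_def, subst (asm) card_le_Suc0_iff_eq) auto
      \<comment> \<open>If \<open>z\<close> is the only universal vertex, \<open>y'\<close> is
        arbitrary and need not even be a vertex.\<close>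
      then obtain y' where y': "universal_vertices G - {z} \<subseteq> {y'}" by blast
      have "verts G - {z} \<noteq> {}"
      proof
        assume "verts G - {z} = {}"
        then have "card (verts G) \<le> card {z}" by (intro card_mono) auto
        then show False using assms(3) by simp
      qed
      \<comment> \<open>If \<open>z\<close> is the only universal vertex, any other vertex serves as
        \<open>y\<close>; otherwise \<open>y'\<close> is itself universal and serves. Either way
        \<open>{z, y}\<close> is an edge containing all universal vertices.\<close>
      then obtain y where "y \<in> verts G" "y \<noteq> z" "universal_vertices G \<subseteq> {z, y}"
        using y' U by (cases "universal_vertices G \<subseteq> {z}") blast+
      then show False using noe universal_vertices_pair[OF z] by metis
    qed
  next
    assume card: "card (universal_vertices G) \<ge> 3"
    have "\<not> universal_vertices G \<subseteq> e" if "e \<in> edges G" for e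
    proof
      have "card e = 2" using assms(1) that by (simp add: finite_simple_graph_def)
      moreover assume "universal_vertices G \<subseteq> e"
      \<comment> \<open>Monotonicity of \<open>card\<close> needs \<open>e\<close> finite, which
        follows from \<open>card e = 2\<close> because infinite sets have cardinality 0.\<close>
      ultimately have "card (universal_vertices G) \<le> 2"
        by (metis card_mono card.infinite zero_neq_numeral)
      then show False using card by simp
    qed
    then show "ASR_graph G" using ASR by blast
  qed
qed

section \<open>Sums with K_3 and isomorphism\<close>

lemma adj_graph_sum:
  "adj (graph_sum G H) x y \<longleftrightarrow> adj G x y \<or> adj H x y
    \<or> x \<in> verts G \<and> y \<in> verts H \<or> y \<in> verts G \<and> x \<in> verts H"
  by (auto simp: graph_sum_def adj_def doubleton_eq_iff)

lemma verts_graph_sum [simp]: "verts (graph_sum G H) = verts G \<union> verts H"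
  by (simp add: graph_sum_def)

lemma verts_complete_graph [simp]: "verts (complete_graph V) = V"
  by (simp add: complete_graph_def)

lemma adj_complete_graph: "adj (complete_graph V) x y \<longleftrightarrow> x \<in> V \<and> y \<in> V \<and> x \<noteq> y"
  by (auto simp: complete_graph_def adj_def doubleton_eq_iff)

text \<open>A pair of distinct vertices meeting \<open>V\<close> is joined inside the complete part
  or across the sum; disjointness keeps the cross edges from being loops.\<close>

lemma adj_complete_graph_sum:
  assumes "finite_simple_graph H" "V \<inter> verts H = {}"
    and "x \<in> V \<union> verts H" "y \<in> V \<union> verts H" "x \<in> V \<or> y \<in> V"
  shows "adj (graph_sum (complete_graph V) H) x y \<longleftrightarrow> x \<noteq> y"
  using assms(2-5) adj_verts[OF assms(1), of x y]
  by (auto simp: adj_graph_sum adj_complete_graph)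

lemma K3_subset_universal_vertices_sum:
  "{0, 1, 2} \<subseteq> universal_vertices (graph_sum K3 H)"
  by (auto simp: universal_vertices_def adj_graph_sum adj_complete_graph K3_def)

text \<open>Preimages of universal vertices are universal. This inequality carries the three
  universal vertices of a sum with K_3 back to \<open>G\<close>.\<close>

lemma card_universal_vertices_isomorphic_le:
  assumes "graph_isomorphic G H" "finite (verts G)"
  shows "card (universal_vertices H) \<le> card (universal_vertices G)"
proof -
  obtain f where bij: "bij_betw f (verts G) (verts H)"
    and f: "\<And>u v. u \<in> verts G \<Longrightarrow> v \<in> verts G \<Longrightarrow> adj G u v \<longleftrightarrow> adj H (f u) (f v)"
    using assms(1) by (auto simp: graph_isomorphic_def)
  have "universal_vertices H \<subseteq> f ` universal_vertices G"
  proof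
    fix x assume x: "x \<in> universal_vertices H"
    then obtain u where u: "u \<in> verts G" "x = f u"
      using bij by (auto simp: universal_vertices_def bij_betw_def)
    have "adj G u v" if "v \<in> verts G" "v \<noteq> u" for v
    proof -
      have "f v \<in> verts H" "f v \<noteq> f u"
        using bij that u(1) by (auto simp: bij_betw_def inj_on_eq_iff)
      then show ?thesis using x u that f by (simp add: universal_vertices_def)
    qed
    then show "x \<in> f ` universal_vertices G" using u by (auto simp: universal_vertices_def)
  qed
  moreover have "finite (universal_vertices G)"
    using assms(2) by (simp add: universal_vertices_def)
  ultimately show ?thesis by (meson card_image_le card_mono finite_imageI le_trans)
qed

text \<open>Three universal vertices \<open>T\<close> become the vertices of \<open>K3\<close>, and
  \<open>H\<close> is a copy of the subgraph induced on the remaining vertices \<open>R\<close>,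
  null if \<open>R\<close> is empty.\<close>

lemma isomorphic_K3_sum:
  assumes "finite_simple_graph G" "card (universal_vertices G) \<ge> 3"
  obtains H :: "nat graph"
  where "finite_simple_graph H" "verts K3 \<inter> verts H = {}"
    "graph_isomorphic G (graph_sum K3 H)"
proof -
  have fin: "finite (verts G)" using assms(1) by (simp add: finite_simple_graph_def)
  obtain T where T: "T \<subseteq> universal_vertices G" "card T = 3" "finite T"
    using obtain_subset_with_card_n[OF assms(2)] by metis
  have TV: "T \<subseteq> verts G" using T(1) by (auto simp: universal_vertices_def)
  define R where "R = verts G - T"
  have "card T = card {0, 1, 2::nat}" using T(2) by simp
  then obtain h where h: "bij_betw h T {0, 1, 2::nat}"
    using finite_same_card_bij[OF T(3), of "{0, 1, 2::nat}"] by auto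
  have "finite R" using fin by (simp add: R_def)
  moreover have "card R = card {3..<3 + card R}" by simp
  \<comment> \<open>Numbering \<open>R\<close> from 3 onwards keeps the vertices of \<open>H\<close>
    disjoint from 0, 1, 2.\<close>
  ultimately obtain g where g: "bij_betw g R {3..<3 + card R}"
    using finite_same_card_bij[of R "{3..<3 + card R}"] by auto
  define f where "f x = (if x \<in> T then h x else g x)" for x
  have fT: "bij_betw f T {0, 1, 2}" using h by (subst bij_betw_cong[of T f h]) (auto simp: f_def)
  have fR: "bij_betw f R {3..<3 + card R}"
    using g by (subst bij_betw_cong[of R f g]) (auto simp: f_def R_def)
  have V: "verts G = T \<union> R" using TV by (auto simp: R_def)
  have f: "bij_betw f (verts G) ({0, 1, 2} \<union> {3..<3 + card R})"
    unfolding V using fT fR by (rule bij_betw_combine) auto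
  define H where "H = Graph {3..<3 + card R} ((`) f ` {e \<in> edges G. e \<subseteq> R})"
  have vH: "verts H = {3..<3 + card R}" by (simp add: H_def)
  have injR: "inj_on f R" and imR: "f ` R = {3..<3 + card R}"
    using fR by (auto simp: bij_betw_def)
  have H: "finite_simple_graph H"
  proof -
    have "f ` e \<subseteq> {3..<3 + card R} \<and> card (f ` e) = 2" if "e \<in> edges G" "e \<subseteq> R" for e
      using that assms(1) injR image_mono[OF that(2), of f] imR
      by (simp add: finite_simple_graph_def card_image inj_on_subset)
    then show ?thesis by (simp add: finite_simple_graph_def H_def)
  qed
  have adjH: "adj H (f u) (f v) \<longleftrightarrow> adj G u v" if "u \<in> R" "v \<in> R" for u v
  proof -
    have "{f u, f v} = f ` e \<longleftrightarrow> {u, v} = e" if "e \<subseteq> R" for e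
      using inj_on_image_eq_iff[OF injR, of "{u, v}" e] that \<open>u \<in> R\<close> \<open>v \<in> R\<close> by simp
    moreover have "adj H (f u) (f v) \<longleftrightarrow> (\<exists>e\<in>edges G. e \<subseteq> R \<and> {f u, f v} = f ` e)"
      by (auto simp: adj_def H_def)
    ultimately show ?thesis using that by (auto simp: adj_def)
  qed
  have "adj G u v \<longleftrightarrow> adj (graph_sum K3 H) (f u) (f v)"
    if "u \<in> verts G" "v \<in> verts G" for u v
  \<comment> \<open>Inside \<open>R\<close>, both images are at least 3, so only edges of
    \<open>H\<close> can join them. For a pair meeting \<open>T\<close>, adjacency on either side
    just means being distinct.\<close>
  proof (cases "u \<in> R \<and> v \<in> R")
    case True
    then have "f u \<ge> 3" "f v \<ge> 3" using imR by auto
    then show ?thesis using True adjH by (auto simp: adj_graph_sum adj_complete_graph K3_def)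
  next
    case False
    then have *: "u \<in> T \<or> v \<in> T" using that V by blast
    then have "adj G u v \<longleftrightarrow> u \<noteq> v"
      using T(1) that adj_verts(3)[OF assms(1)] adj_commute[of G u v]
      by (auto simp: universal_vertices_def)
    moreover have "adj (graph_sum K3 H) (f u) (f v) \<longleftrightarrow> f u \<noteq> f v"
    proof -
      have "f u \<in> {0, 1, 2} \<or> f v \<in> {0, 1, 2}"
        using * bij_betw_apply[OF fT, of u] bij_betw_apply[OF fT, of v] by blast
      moreover have "f u \<in> {0, 1, 2} \<union> verts H" "f v \<in> {0, 1, 2} \<union> verts H"
        using bij_betw_apply[OF f that(1)] bij_betw_apply[OF f that(2)]
        by (simp_all only: vH)
      moreover have "{0, 1, 2} \<inter> verts H = {}" by (simp add: vH)
      ultimately show ?thesis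
        unfolding K3_def using H by (intro adj_complete_graph_sum)
    qed
    moreover have "f u = f v \<longleftrightarrow> u = v"
      using f that by (auto simp: bij_betw_def inj_on_eq_iff)
    ultimately show ?thesis by simp
  qed
  then have "graph_isomorphic G (graph_sum K3 H)"
    using f vH unfolding graph_isomorphic_def by (intro exI[of _ f]) (simp add: K3_def)
  moreover have "verts K3 \<inter> verts H = {}" by (simp add: K3_def vH)
  ultimately show ?thesis using H that by blast
qed

theorem theorem13:
  fixes G :: "'a graph"
  assumes "finite_simple_graph G"
    and "connected_graph G"
    and "card (verts G) \<ge> 3"
    and "domination_number G = 1"
  shows "ASR_graph G \<longleftrightarrow>
    (\<exists>H :: nat graph. finite_simple_graph H \<and> verts K3 \<inter> verts H = {} \<and>
       graph_isomorphic G (graph_sum K3 H))"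
proof -
  have "card (universal_vertices G) \<ge> 3"
    if H: "finite_simple_graph H" "graph_isomorphic G (graph_sum K3 H)" for H :: "nat graph"
  proof -
    have "finite (universal_vertices (graph_sum K3 H))"
      using H(1) by (simp add: universal_vertices_def finite_simple_graph_def K3_def)
    then have "card {0, 1, 2::nat} \<le> card (universal_vertices (graph_sum K3 H))"
      using K3_subset_universal_vertices_sum by (rule card_mono)
    also have "\<dots> \<le> card (universal_vertices G)"
      using card_universal_vertices_isomorphic_le[OF H(2)] assms(1)
      by (simp add: finite_simple_graph_def)
    finally show ?thesis by simp
  qed
  then show ?thesis
    using ASR_graph_iff_card_universal_vertices[OF assms] isomorphic_K3_sum[OF assms(1)]
    by metis
qed

end
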